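(* Let $(M,\phi,\xi,\eta,g)$ be a $(2n+1)$-dimensional Kenmotsu manifold, let $a>0$ be a constant, and let $(\overline{\phi},\overline{\xi},\overline{\eta},\overline{g})$ be the $D$-homothetically deformed structure on $M$. Let $f\in C^\infty(M)$. If $(V=\overline{\mathrm{grad}}(f),\overline{\lambda})$ defines a gradient almost Riemann soliton in $(M,\overline{g})$, then $$|\overline{\mathrm{Ric}}|_{\overline{g}}^2\geq (2n-1)^2\left[|\overline{\mathrm{Hess}}(f)|_{\overline{g}}^2-\frac{1}{2n+1}(\overline{\Delta}(f))^2\right].$$
   Context: An almost contact metric manifold $(M,\phi,\xi,\eta,g)$ is an odd-dimensional Riemannian manifold $(M,g)$, here of dimension $2n+1$ with $n\ge 1$, together with a $(1,1)$-tensor field $\phi$, a vector field $\xi$ (the Reeb vector field) and a $1$-form $\eta$ such that $\phi^2=-I+\eta\otimes\xi$, $\eta(\xi)=1$, $\eta=g(\xi,\cdot)$ and $g(\phi X,\phi Y)=g(X,Y)-\eta(X)\eta(Y)$. It is a Kenmotsu manifold if the Levi-Civita connection $\nabla$ of $g$ satisfies $(\nabla_X\phi)Y=g(\phi X,Y)\xi-\eta(Y)\phi X$ for all vector fields $X,Y$. For a constant $a>0$, the $D$-homothetically deformed structure is $\overline{\phi}=\phi$, $\overline{\xi}=\frac{1}{a}\xi$, $\overline{\eta}=a\eta$, $\overline{g}=ag+a(a-1)\eta\otimes\eta$. For a Riemannian metric $h$, a nowhere-vanishing vector field $V$ and a smooth function $\lambda$ on $M$, the pair $(V,\lambda)$ defines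 an almost Riemann soliton in $(M,h)$ if $\frac12\mathcal{L}_Vh\odot h+R_h=\frac{\lambda}{2}\,h\odot h$; it is called gradient if $V$ is the $h$-gradient of a smooth function. Here $\mathcal{L}$ is the Lie derivative; $R_h(X,Y,Z,W)=h(R_h(X,Y)Z,W)$ with $R_h(X,Y)Z=\nabla^h_X\nabla^h_YZ-\nabla^h_Y\nabla^h_XZ-\nabla^h_{[X,Y]}Z$; and for $(0,2)$-tensors $(T_1\odot T_2)(X,Y,Z,W)=T_1(X,W)T_2(Y,Z)+T_1(Y,Z)T_2(X,W)-T_1(X,Z)T_2(Y,W)-T_1(Y,W)T_2(X,Z)$. $\overline{\mathrm{grad}},\overline{\mathrm{Hess}},\overline{\Delta},\overline{\mathrm{Ric}}$ are the gradient, Hessian, Laplace operator (trace of the Hessian) and Ricci tensor of $\overline{g}$. $|T|_{\overline{g}}$ is the Hilbert–Schmidt norm: $|T|_{\overline{g}}^2=\sum_{i,j}T(e_i,e_j)^2$ for a $\overline{g}$-orthonormal frame $(e_i)$. The inequality is pointwise on $M$. *)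

theory Defs
  imports "HOL-Analysis.Analysis" "HOL-Library.Function_Algebras"
begin

text \<open>
  Smooth manifolds are developed coordinate-freely: a manifold is a Hausdorff, second countable
  type with a smooth atlas, vector fields are the derivations of the algebra of smooth functions,
  and tensor fields are the maps on vector fields that are multilinear over the smooth functions.
  Addition, subtraction and multiplication of functions, and addition and subtraction of vector
  fields, are the pointwise operations of \<^theory>\<open>HOL-Library.Function_Algebras\<close>.
\<close>

subsection \<open>Smooth manifolds\<close>

text \<open>The set \<open>S\<close> is meant to be open.\<close>

primrec Ck_on :: "nat \<Rightarrow> 'a::real_normed_vector set \<Rightarrow> ('a \<Rightarrow> 'b::real_normed_vector) \<Rightarrow> bool" where
  "Ck_on 0 S f \<longleftrightarrow> continuous_on S f"
| "Ck_on (Suc k) S f \<longleftrightarrow>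
     f differentiable_on S \<and> (\<forall>v. Ck_on k S (\<lambda>x. frechet_derivative f (at x) v))"

definition smooth_on :: "'a::real_normed_vector set \<Rightarrow> ('a \<Rightarrow> 'b::real_normed_vector) \<Rightarrow> bool" where
  "smooth_on S f \<longleftrightarrow> (\<forall>k. Ck_on k S f)"

text \<open>A chart \<open>(U, c)\<close> is given by its domain and a coordinate map; \<open>c\<close> is irrelevant outside \<open>U\<close>.\<close>

type_synonym ('m, 'd) chart = "'m set \<times> ('m \<Rightarrow> real ^ 'd)"

definition is_chart :: "('m::topological_space, 'd::finite) chart \<Rightarrow> bool" where
  "is_chart = (\<lambda>(U, c). open U \<and> open (c ` U) \<and> (\<exists>c'. homeomorphism U (c ` U) c c'))"

text \<open>The manifold has dimension \<open>CARD('d)\<close>. The atlas need not be maximal.\<close>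

definition smooth_atlas ::
    "('m::{t2_space, second_countable_topology}, 'd::finite) chart set \<Rightarrow> bool" where
  "smooth_atlas A \<longleftrightarrow>
     (\<forall>C\<in>A. is_chart C) \<and> (\<Union>(U, c)\<in>A. U) = UNIV \<and>
     (\<forall>(U, c)\<in>A. \<forall>(U', c')\<in>A. smooth_on (c ` (U \<inter> U')) (c' \<circ> inv_into U c))"

definition smooth_functions ::
    "('m::topological_space, 'd::finite) chart set \<Rightarrow> ('m \<Rightarrow> real) set" where
  "smooth_functions A = {f. \<forall>(U, c)\<in>A. smooth_on (c ` U) (f \<circ> inv_into U c)}"

subsection \<open>Vector fields and tensor fields\<close>

type_synonym 'm vfield = "('m \<Rightarrow> real) \<Rightarrow> 'm \<Rightarrow> real"
type_synonym 'm oneform = "'m vfield \<Rightarrow> 'm \<Rightarrow> real"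
type_synonym 'm tensor11 = "'m vfield \<Rightarrow> 'm vfield"
type_synonym 'm tensor02 = "'m vfield \<Rightarrow> 'm vfield \<Rightarrow> 'm \<Rightarrow> real"
type_synonym 'm connection = "'m vfield \<Rightarrow> 'm vfield \<Rightarrow> 'm vfield"

definition fscale :: "('m \<Rightarrow> real) \<Rightarrow> 'm vfield \<Rightarrow> 'm vfield" (infixr "*\<^sub>F" 75) where
  "h *\<^sub>F X = (\<lambda>f. h * X f)"

text \<open>A derivation is set to \<open>0\<close> on functions that are not smooth, so that equality in HOL is
  equality of vector fields; sums, \<open>*\<^sub>F\<close> and the bracket preserve this convention.\<close>

definition vector_fields ::
    "('m::topological_space, 'd::finite) chart set \<Rightarrow> 'm vfield set" where
  "vector_fields A = {X.
     (\<forall>f\<in>smooth_functions A. X f \<in> smooth_functions A) \<and>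
     (\<forall>f\<in>smooth_functions A. \<forall>g\<in>smooth_functions A. X (f + g) = X f + X g) \<and>
     (\<forall>r. \<forall>f\<in>smooth_functions A. X ((\<lambda>_. r) * f) = (\<lambda>_. r) * X f) \<and>
     (\<forall>f\<in>smooth_functions A. \<forall>g\<in>smooth_functions A. X (f * g) = X f * g + f * X g) \<and>
     (\<forall>f. f \<notin> smooth_functions A \<longrightarrow> X f = 0)}"

text \<open>\<open>X\<close> is nonzero at \<open>p\<close> as a tangent vector, i.e. as a derivation at \<open>p\<close>.\<close>

definition nonzero_at ::
    "('m::topological_space, 'd::finite) chart set \<Rightarrow> 'm vfield \<Rightarrow> 'm \<Rightarrow> bool" where
  "nonzero_at A X p \<longleftrightarrow> (\<exists>f\<in>smooth_functions A. X f p \<noteq> 0)"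

definition bracket :: "'m vfield \<Rightarrow> 'm vfield \<Rightarrow> 'm vfield" where
  "bracket X Y = (\<lambda>f. X (Y f) - Y (X f))"

text \<open>Values of tensor fields on arguments that are not vector fields are irrelevant.\<close>

definition one_form ::
    "('m::topological_space, 'd::finite) chart set \<Rightarrow> 'm oneform \<Rightarrow> bool" where
  "one_form A \<alpha> \<longleftrightarrow>
     (\<forall>X\<in>vector_fields A. \<alpha> X \<in> smooth_functions A) \<and>
     (\<forall>X\<in>vector_fields A. \<forall>Y\<in>vector_fields A. \<alpha> (X + Y) = \<alpha> X + \<alpha> Y) \<and>
     (\<forall>h\<in>smooth_functions A. \<forall>X\<in>vector_fields A. \<alpha> (h *\<^sub>F X) = h * \<alpha> X)"

definition tensor11 ::
    "('m::topological_space, 'd::finite) chart set \<Rightarrow> 'm tensor11 \<Rightarrow> bool" where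
  "tensor11 A \<phi> \<longleftrightarrow>
     (\<forall>X\<in>vector_fields A. \<phi> X \<in> vector_fields A) \<and>
     (\<forall>X\<in>vector_fields A. \<forall>Y\<in>vector_fields A. \<phi> (X + Y) = \<phi> X + \<phi> Y) \<and>
     (\<forall>h\<in>smooth_functions A. \<forall>X\<in>vector_fields A. \<phi> (h *\<^sub>F X) = h *\<^sub>F \<phi> X)"

definition tensor02 ::
    "('m::topological_space, 'd::finite) chart set \<Rightarrow> 'm tensor02 \<Rightarrow> bool" where
  "tensor02 A T \<longleftrightarrow>
     (\<forall>X\<in>vector_fields A. one_form A (T X)) \<and>
     (\<forall>Y\<in>vector_fields A. one_form A (\<lambda>X. T X Y))"

definition lie_derivative :: "'m vfield \<Rightarrow> 'm tensor02 \<Rightarrow> 'm tensor02" where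
  "lie_derivative V T = (\<lambda>X Y. V (T X Y) - T (bracket V X) Y - T X (bracket V Y))"

subsection \<open>Riemannian geometry\<close>

definition riemannian_metric ::
    "('m::topological_space, 'd::finite) chart set \<Rightarrow> 'm tensor02 \<Rightarrow> bool" where
  "riemannian_metric A h \<longleftrightarrow>
     tensor02 A h \<and>
     (\<forall>X\<in>vector_fields A. \<forall>Y\<in>vector_fields A. h X Y = h Y X) \<and>
     (\<forall>X\<in>vector_fields A. \<forall>p. nonzero_at A X p \<longrightarrow> h X X p > 0)"

definition affine_connection ::
    "('m::topological_space, 'd::finite) chart set \<Rightarrow> 'm connection \<Rightarrow> bool" where
  "affine_connection A D \<longleftrightarrow>
     (\<forall>X\<in>vector_fields A. \<forall>Y\<in>vector_fields A. D X Y \<in> vector_fields A) \<and>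
     (\<forall>X\<in>vector_fields A. \<forall>X'\<in>vector_fields A. \<forall>Y\<in>vector_fields A. D (X + X') Y = D X Y + D X' Y) \<and>
     (\<forall>X\<in>vector_fields A. \<forall>Y\<in>vector_fields A. \<forall>Y'\<in>vector_fields A. D X (Y + Y') = D X Y + D X Y') \<and>
     (\<forall>u\<in>smooth_functions A. \<forall>X\<in>vector_fields A. \<forall>Y\<in>vector_fields A.
        D (u *\<^sub>F X) Y = u *\<^sub>F D X Y) \<and>
     (\<forall>u\<in>smooth_functions A. \<forall>X\<in>vector_fields A. \<forall>Y\<in>vector_fields A.
        D X (u *\<^sub>F Y) = X u *\<^sub>F Y + u *\<^sub>F D X Y)"

definition levi_civita ::
    "('m::topological_space, 'd::finite) chart set \<Rightarrow> 'm tensor02 \<Rightarrow> 'm connection \<Rightarrow> bool" where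
  "levi_civita A h D \<longleftrightarrow>
     affine_connection A D \<and>
     (\<forall>X\<in>vector_fields A. \<forall>Y\<in>vector_fields A. D X Y - D Y X = bracket X Y) \<and>
     (\<forall>X\<in>vector_fields A. \<forall>Y\<in>vector_fields A. \<forall>Z\<in>vector_fields A.
        X (h Y Z) = h (D X Y) Z + h Y (D X Z))"

definition curvature :: "'m connection \<Rightarrow> 'm vfield \<Rightarrow> 'm vfield \<Rightarrow> 'm vfield \<Rightarrow> 'm vfield" where
  "curvature D X Y Z = D X (D Y Z) - D Y (D X Z) - D (bracket X Y) Z"

definition is_gradient ::
    "('m::topological_space, 'd::finite) chart set \<Rightarrow> 'm tensor02 \<Rightarrow> ('m \<Rightarrow> real) \<Rightarrow> 'm vfield \<Rightarrow> bool" where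
  "is_gradient A h f V \<longleftrightarrow> V \<in> vector_fields A \<and> (\<forall>X\<in>vector_fields A. h V X = X f)"

definition hessian :: "'m connection \<Rightarrow> ('m \<Rightarrow> real) \<Rightarrow> 'm tensor02" where
  "hessian D f = (\<lambda>X Y. X (Y f) - (D X Y) f)"

text \<open>An \<open>h\<close>-orthonormal basis of the tangent space at \<open>p\<close>, each basis vector being given by a
  global vector field through it. Traces and norms of tensor fields at \<open>p\<close> do not depend on the
  choice of the basis, nor on the choice of the extensions.\<close>

definition orthonormal_basis_at ::
    "('m::topological_space, 'd::finite) chart set \<Rightarrow> 'm tensor02 \<Rightarrow> 'm \<Rightarrow> ('d \<Rightarrow> 'm vfield) \<Rightarrow> bool" where
  "orthonormal_basis_at A h p e \<longleftrightarrow>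
     (\<forall>i. e i \<in> vector_fields A) \<and> (\<forall>i j. h (e i) (e j) p = (if i = j then 1 else 0))"

definition some_basis_at ::
    "('m::topological_space, 'd::finite) chart set \<Rightarrow> 'm tensor02 \<Rightarrow> 'm \<Rightarrow> 'd \<Rightarrow> 'm vfield" where
  "some_basis_at A h p = (SOME e. orthonormal_basis_at A h p e)"

definition metric_trace ::
    "('m::topological_space, 'd::finite) chart set \<Rightarrow> 'm tensor02 \<Rightarrow> 'm tensor02 \<Rightarrow> 'm \<Rightarrow> real" where
  "metric_trace A h T p =
     (let e = some_basis_at A h p in \<Sum>i\<in>UNIV. T (e i) (e i) p)"

definition hs_norm ::
    "('m::topological_space, 'd::finite) chart set \<Rightarrow> 'm tensor02 \<Rightarrow> 'm tensor02 \<Rightarrow> 'm \<Rightarrow> real" where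
  "hs_norm A h T p =
     (let e = some_basis_at A h p in sqrt (\<Sum>i\<in>UNIV. \<Sum>j\<in>UNIV. (T (e i) (e j) p)\<^sup>2))"

text \<open>\<open>Ric(Y, Z)\<close> is the trace of \<open>X \<mapsto> R(X, Y)Z\<close>.\<close>

definition ricci ::
    "('m::topological_space, 'd::finite) chart set \<Rightarrow> 'm tensor02 \<Rightarrow> 'm connection \<Rightarrow> 'm tensor02" where
  "ricci A h D = (\<lambda>Y Z. metric_trace A h (\<lambda>X W. h (curvature D X Y Z) W))"

definition laplacian ::
    "('m::topological_space, 'd::finite) chart set \<Rightarrow> 'm tensor02 \<Rightarrow> 'm connection \<Rightarrow>
     ('m \<Rightarrow> real) \<Rightarrow> 'm \<Rightarrow> real" where
  "laplacian A h D f = metric_trace A h (hessian D f)"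

subsection \<open>Kenmotsu manifolds and almost Riemann solitons\<close>

definition almost_contact_metric ::
    "('m::topological_space, 'd::finite) chart set \<Rightarrow>
     'm tensor11 \<times> 'm vfield \<times> 'm oneform \<times> 'm tensor02 \<Rightarrow> bool" where
  "almost_contact_metric A = (\<lambda>(\<phi>, \<xi>, \<eta>, g).
     riemannian_metric A g \<and> tensor11 A \<phi> \<and> \<xi> \<in> vector_fields A \<and> one_form A \<eta> \<and>
     (\<forall>X\<in>vector_fields A. \<phi> (\<phi> X) = \<eta> X *\<^sub>F \<xi> - X) \<and>
     \<eta> \<xi> = 1 \<and>
     (\<forall>X\<in>vector_fields A. \<eta> X = g \<xi> X) \<and>
     (\<forall>X\<in>vector_fields A. \<forall>Y\<in>vector_fields A. g (\<phi> X) (\<phi> Y) = g X Y - \<eta> X * \<eta> Y))"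

text \<open>\<open>D\<close> is the Levi-Civita connection of the metric;
  \<open>(\<nabla>\<^sub>X\<phi>)Y = \<nabla>\<^sub>X(\<phi>Y) - \<phi>(\<nabla>\<^sub>XY)\<close>.\<close>

definition kenmotsu ::
    "('m::topological_space, 'd::finite) chart set \<Rightarrow>
     'm tensor11 \<times> 'm vfield \<times> 'm oneform \<times> 'm tensor02 \<Rightarrow> 'm connection \<Rightarrow> bool" where
  "kenmotsu A = (\<lambda>(\<phi>, \<xi>, \<eta>, g) D.
     almost_contact_metric A (\<phi>, \<xi>, \<eta>, g) \<and> levi_civita A g D \<and>
     (\<forall>X\<in>vector_fields A. \<forall>Y\<in>vector_fields A.
        D X (\<phi> Y) - \<phi> (D X Y) = g (\<phi> X) Y *\<^sub>F \<xi> - \<eta> Y *\<^sub>F \<phi> X))"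

definition D_homothetic ::
    "real \<Rightarrow> 'm tensor11 \<times> 'm vfield \<times> 'm oneform \<times> 'm tensor02 \<Rightarrow>
     'm tensor11 \<times> 'm vfield \<times> 'm oneform \<times> 'm tensor02" where
  "D_homothetic a = (\<lambda>(\<phi>, \<xi>, \<eta>, g).
     (\<phi>, (\<lambda>_. 1 / a) *\<^sub>F \<xi>, (\<lambda>X. (\<lambda>_. a) * \<eta> X),
      (\<lambda>X Y. (\<lambda>_. a) * g X Y + (\<lambda>_. a * (a - 1)) * (\<eta> X * \<eta> Y))))"

definition kulkarni_nomizu ::
    "'m tensor02 \<Rightarrow> 'm tensor02 \<Rightarrow>
     'm vfield \<Rightarrow> 'm vfield \<Rightarrow> 'm vfield \<Rightarrow> 'm vfield \<Rightarrow> 'm \<Rightarrow> real" where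
  "kulkarni_nomizu S T X Y Z W = S X W * T Y Z + S Y Z * T X W - S X Z * T Y W - S Y W * T X Z"

definition almost_riemann_soliton ::
    "('m::topological_space, 'd::finite) chart set \<Rightarrow> 'm tensor02 \<Rightarrow> 'm connection \<Rightarrow>
     'm vfield \<Rightarrow> ('m \<Rightarrow> real) \<Rightarrow> bool" where
  "almost_riemann_soliton A h D V l \<longleftrightarrow>
     V \<in> vector_fields A \<and> (\<forall>p. nonzero_at A V p) \<and> l \<in> smooth_functions A \<and>
     (\<forall>X\<in>vector_fields A. \<forall>Y\<in>vector_fields A. \<forall>Z\<in>vector_fields A. \<forall>W\<in>vector_fields A.
        kulkarni_nomizu (\<lambda>X Y. (\<lambda>_. 1 / 2) * lie_derivative V h X Y) h X Y Z W
          + h (curvature D X Y Z) W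
        = (\<lambda>p. l p / 2) * kulkarni_nomizu h h X Y Z W)"

end

theory Submission
  imports Defs "HOL-Computational_Algebra.Polynomial"
begin

text \<open>
  Let \<open>h\<close> be a Riemannian metric in dimension \<open>m\<close>, with Levi-Civita connection \<open>D\<close>. If \<open>V\<close> is the
  gradient of \<open>f\<close>, half the Lie derivative of \<open>h\<close> along \<open>V\<close> is the Hessian of \<open>f\<close>
  (\<open>half_lie_derivative_gradient\<close>). The soliton equation then expresses the curvature tensor by \<open>h\<close> and
  the Hessian, and its trace is
  \<open>Ric = ((m - 1) \<lambda> - \<Delta>f) h - (m - 2) Hess f\<close>
  (\<open>ricci_of_gradient_almost_riemann_soliton\<close>). A multiple of \<open>h\<close> changes only the pure-trace part of
  a symmetric tensor. So the trace-free parts of \<open>Ric\<close> and \<open>-(m - 2) Hess f\<close> agree, and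
  \<open>|Ric|\<^sup>2\<close> is at least the squared norm of this trace-free part, \<open>(m - 2)\<^sup>2 (|Hess f|\<^sup>2 - (\<Delta>f)\<^sup>2 / m)\<close>
  (\<open>norm_of_pure_trace_minus_multiple\<close>). With \<open>m = 2n + 1\<close> this is the inequality claimed.

  This applies to the deformed metric because it is a Riemannian metric: \<open>g(\<phi>X, \<phi>X) \<ge> 0\<close>
  bounds \<open>\<eta>(X)\<^sup>2\<close> by \<open>g(X, X)\<close>, which keeps it positive for every \<open>a > 0\<close>
  (\<open>D_homothetic_metric_riemannian\<close>).

  Traces and norms at \<open>p\<close> are sums over a chosen basis, orthonormal at \<open>p\<close>, that consists of
  global vector fields. Such a basis has to be shown to exist. Coordinate fields of a chart around
  \<open>p\<close>, multiplied by a smooth bump function, extend by zero to derivations of the algebra of global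
  smooth functions (\<open>vector_fields_spanning_tangent_space\<close>), and Gram-Schmidt does the rest
  (\<open>orthonormal_basis_exists\<close>). Most of the development serves this step: a calculus for
  \<^const>\<open>Ck_on\<close>, the function \<open>exp (-1/t)\<close>, and the extension of compactly supported functions beyond a chart.
\<close>

section \<open>Calculus of smooth maps\<close>

lemma Ck_on_Suc_imp: "Ck_on (Suc k) S f \<Longrightarrow> Ck_on k S f"
proof (induction k arbitrary: f)
  case 0
  then show ?case by (auto simp: differentiable_imp_continuous_on)
next
  case (Suc k)
  from Suc.prems have d: "f differentiable_on S"
    and k: "\<And>v. Ck_on (Suc k) S (\<lambda>x. frechet_derivative f (at x) v)"
    by auto
  show ?case
    unfolding Ck_on.simps using d Suc.IH[OF k] by blast
qed

text \<open>
  The derivatives in \<open>Ck_on\<close> are two-sided derivatives of a total function, so a function may be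
  replaced by one that agrees with it on \<open>S\<close> only when \<open>S\<close> is open.
\<close>

lemma Ck_on_cong:
  assumes "open S" "\<And>x. x \<in> S \<Longrightarrow> f x = g x" "Ck_on k S f"
  shows "Ck_on k S g"
  using assms(2,3)
proof (induction k arbitrary: f g)
  case 0
  then show ?case by (simp cong: continuous_on_cong)
next
  case (Suc k)
  have der: "(g has_derivative frechet_derivative f (at x)) (at x)" if x: "x \<in> S" for x
  proof (rule has_derivative_transform_within_open[OF _ assms(1) x])
    show "(f has_derivative frechet_derivative f (at x)) (at x)"
      using Suc.prems(2) x assms(1)
      by (auto simp: differentiable_on_eq_differentiable_at frechet_derivative_works)
  qed (use Suc.prems(1) in auto)
  have "g differentiable_on S"
    using der by (auto simp: differentiable_on_eq_differentiable_at[OF assms(1)] differentiable_def)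
  moreover have "Ck_on k S (\<lambda>x. frechet_derivative g (at x) v)" for v
    by (rule Suc.IH[of "\<lambda>x. frechet_derivative f (at x) v"])
      (use Suc.prems(2) frechet_derivative_at[OF der] in auto)
  ultimately show ?case by simp
qed

text \<open>
  The introduction rule behind the closure properties below: it lets a derivative be given by a
  formula, so that \<open>frechet_derivative\<close> never has to be computed.
\<close>

lemma Ck_on_SucI:
  assumes "open S" "\<And>x. x \<in> S \<Longrightarrow> (f has_derivative f' x) (at x)"
    "\<And>v. Ck_on k S (\<lambda>x. f' x v)"
  shows "Ck_on (Suc k) S f"
proof -
  have "f differentiable_on S"
    using assms(1,2) by (auto simp: differentiable_on_eq_differentiable_at differentiable_def)
  moreover have "Ck_on k S (\<lambda>x. frechet_derivative f (at x) v)" for v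
    by (rule Ck_on_cong[OF assms(1) _ assms(3)[of v]])
      (use frechet_derivative_at[OF assms(2)] in auto)
  ultimately show ?thesis by simp
qed

lemma Ck_on_Suc_has_derivative:
  assumes "open S" "Ck_on (Suc k) S f" "x \<in> S"
  shows "(f has_derivative frechet_derivative f (at x)) (at x)"
  using assms by (auto simp: differentiable_on_eq_differentiable_at frechet_derivative_works)

lemma Ck_on_subset:
  assumes "T \<subseteq> S" "Ck_on k S f"
  shows "Ck_on k T f"
  using assms(2)
  by (induction k arbitrary: f)
    (use assms(1) in \<open>auto intro: continuous_on_subset differentiable_on_subset\<close>)

text \<open>
  Being \<open>C\<^sup>k\<close> is a local property. This is what glues an extension by zero to the
  function it extends.
\<close>

lemma Ck_on_Un:
  assumes "open S" "open T" "Ck_on k S f" "Ck_on k T f"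
  shows "Ck_on k (S \<union> T) f"
  using assms(3,4)
proof (induction k arbitrary: f)
  case 0
  then show ?case using assms by (simp add: continuous_on_open_Un)
next
  case (Suc k)
  then show ?case
    using assms(1,2) by (auto simp: differentiable_on_eq_differentiable_at open_Un)
qed

lemma Ck_on_const: "open S \<Longrightarrow> Ck_on k S (\<lambda>x. c)"
proof (induction k arbitrary: c)
  case (Suc k)
  show ?case
    by (rule Ck_on_SucI[where f' = "\<lambda>x v. 0"]) (use Suc in auto)
qed simp

lemma Ck_on_bounded_linear_compose:
  assumes "bounded_linear L" "open S" "Ck_on k S f"
  shows "Ck_on k S (\<lambda>x. L (f x))"
  using assms(3)
proof (induction k arbitrary: f)
  case 0
  then show ?case using assms(1) by (auto intro: bounded_linear.continuous_on)
next
  case (Suc k)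
  show ?case
    by (rule Ck_on_SucI[where f' = "\<lambda>x v. L (frechet_derivative f (at x) v)"])
      (use Suc assms in \<open>auto intro!: bounded_linear.has_derivative[OF assms(1)]
         intro: Ck_on_Suc_has_derivative\<close>)
qed

lemma Ck_on_add:
  assumes "open S" "Ck_on k S f" "Ck_on k S g"
  shows "Ck_on k S (\<lambda>x. f x + g x)"
  using assms(2,3)
proof (induction k arbitrary: f g)
  case 0
  then show ?case by (auto intro: continuous_on_add)
next
  case (Suc k)
  show ?case
    by (rule Ck_on_SucI[where f' = "\<lambda>x v. frechet_derivative f (at x) v + frechet_derivative g (at x) v"])
      (use Suc assms(1) in \<open>auto intro!: has_derivative_add
         intro: Ck_on_Suc_has_derivative\<close>)
qed

lemma Ck_on_sum:
  assumes "open S" "\<And>i. i \<in> I \<Longrightarrow> Ck_on k S (f i)"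
  shows "Ck_on k S (\<lambda>x. \<Sum>i\<in>I. f i x)"
proof (cases "finite I")
  case True
  then show ?thesis
    using assms(2) by (induction I) (auto intro: Ck_on_const Ck_on_add assms(1))
qed (simp add: Ck_on_const assms(1))

lemma Ck_on_bounded_bilinear:
  assumes "bounded_bilinear B" "open S" "Ck_on k S f" "Ck_on k S g"
  shows "Ck_on k S (\<lambda>x. B (f x) (g x))"
  using assms(3,4)
proof (induction k arbitrary: f g)
  case 0
  then show ?case using assms(1) by (auto intro: bounded_bilinear.continuous_on)
next
  case (Suc k)
  show ?case
  proof (rule Ck_on_SucI[OF assms(2)])
    show "((\<lambda>x. B (f x) (g x)) has_derivative
        (\<lambda>v. B (f x) (frechet_derivative g (at x) v) + B (frechet_derivative f (at x) v) (g x))) (at x)"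
      if "x \<in> S" for x
      using that Suc.prems assms(2)
      by (intro bounded_bilinear.FDERIV[OF assms(1)] Ck_on_Suc_has_derivative)
    show "Ck_on k S (\<lambda>x. B (f x) (frechet_derivative g (at x) v)
        + B (frechet_derivative f (at x) v) (g x))" for v
      using Suc.prems
      by (intro Ck_on_add Suc.IH assms(2)) (auto simp del: Ck_on.simps intro: Ck_on_Suc_imp, auto)
  qed
qed

text \<open>
  In an orthonormal basis the chain rule reads
  \<open>D(f \<circ> g)(x) v = \<Sum>\<^sub>i (Dg(x) v \<bullet> i) \<cdot> Df(g x) i\<close>. Every factor on the right is \<open>C\<^sup>k\<close> when
  \<open>f\<close> and \<open>g\<close> are \<open>C\<^sup>k\<^sup>+\<^sup>1\<close>, the factor \<open>Df(g x) i\<close> by the induction hypothesis; the sum is finite,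
  which is why the middle space has to be Euclidean.
\<close>

lemma Ck_on_compose:
  fixes g :: "'a::real_normed_vector \<Rightarrow> 'b::euclidean_space"
  assumes "open S" "open T" "g ` S \<subseteq> T" "Ck_on k T f" "Ck_on k S g"
  shows "Ck_on k S (\<lambda>x. f (g x))"
  using assms(4,5)
proof (induction k arbitrary: f)
  case 0
  then show ?case using assms(3) by (auto intro: continuous_on_compose2)
next
  case (Suc k)
  let ?Df = "\<lambda>y. frechet_derivative f (at y)" and ?Dg = "\<lambda>x. frechet_derivative g (at x)"
  show ?case
  proof (rule Ck_on_SucI[OF assms(1)])
    fix x assume x: "x \<in> S"
    then have df: "(f has_derivative ?Df (g x)) (at (g x))"
      using assms(2,3) Suc.prems by (intro Ck_on_Suc_has_derivative) auto
    have dg: "(g has_derivative ?Dg x) (at x)"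
      using x assms Suc.prems by (intro Ck_on_Suc_has_derivative)
    interpret bounded_linear "?Df (g x)"
      using df by (rule has_derivative_bounded_linear)
    have "?Df (g x) (?Dg x v) = (\<Sum>i\<in>Basis. (?Dg x v \<bullet> i) *\<^sub>R ?Df (g x) i)" for v
      by (subst euclidean_representation[symmetric, of "?Dg x v"]) (simp add: sum scaleR)
    with has_derivative_compose[OF dg df]
    show "((\<lambda>x. f (g x)) has_derivative
        (\<lambda>v. \<Sum>i\<in>Basis. (?Dg x v \<bullet> i) *\<^sub>R ?Df (g x) i)) (at x)"
      by simp
  next
    fix v
    have "Ck_on k S g" using Suc.prems(2) by (rule Ck_on_Suc_imp)
    then have "Ck_on k S (\<lambda>x. ?Df (g x) i)" for i
      using Suc.prems by (intro Suc.IH) auto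
    moreover have "Ck_on k S (\<lambda>x. ?Dg x v \<bullet> i)" for i
      using Suc.prems
      by (intro Ck_on_bounded_linear_compose[OF bounded_linear_inner_left] assms(1)) auto
    ultimately show "Ck_on k S (\<lambda>x. \<Sum>i\<in>Basis. (?Dg x v \<bullet> i) *\<^sub>R ?Df (g x) i)"
      by (intro Ck_on_sum Ck_on_bounded_bilinear[OF bounded_bilinear_scaleR] assms(1))
  qed
qed

lemma smooth_on_directional_derivative:
  "smooth_on S f \<Longrightarrow> smooth_on S (\<lambda>x. frechet_derivative f (at x) v)"
  unfolding smooth_on_def using Ck_on.simps(2) by blast

lemma smooth_on_has_derivative:
  assumes "open S" "smooth_on S f" "x \<in> S"
  shows "(f has_derivative frechet_derivative f (at x)) (at x)"
  using assms Ck_on_Suc_has_derivative unfolding smooth_on_def by blast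

lemma Ck_on_bounded_linear: "bounded_linear L \<Longrightarrow> open S \<Longrightarrow> Ck_on k S L"
proof (cases k)
  case (Suc j)
  assume *: "bounded_linear L" "open S"
  show ?thesis unfolding Suc
    by (rule Ck_on_SucI[where f' = "\<lambda>x. L"])
      (use * in \<open>auto intro: bounded_linear_imp_has_derivative Ck_on_const\<close>)
qed (simp add: linear_continuous_on)

lemma smooth_on_add:
  "open S \<Longrightarrow> smooth_on S f \<Longrightarrow> smooth_on S g \<Longrightarrow> smooth_on S (\<lambda>x. f x + g x)"
  unfolding smooth_on_def by (blast intro: Ck_on_add)

lemma smooth_on_mult:
  fixes f g :: "'a::real_normed_vector \<Rightarrow> real"
  shows "open S \<Longrightarrow> smooth_on S f \<Longrightarrow> smooth_on S g \<Longrightarrow> smooth_on S (\<lambda>x. f x * g x)"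
  unfolding smooth_on_def by (blast intro: Ck_on_bounded_bilinear[OF bounded_bilinear_mult])

section \<open>Smooth bump functions\<close>

text \<open>
  For \<open>P = 1\<close> this is the standard smooth function \<open>exp (-1/t)\<close> on \<open>t > 0\<close>, flat at \<open>0\<close>. The polynomial
  factor makes the family closed under differentiation.
\<close>

definition flat_exp :: "real poly \<Rightarrow> real \<Rightarrow> real" where
  "flat_exp P t = (if t > 0 then poly P (1 / t) * exp (- (1 / t)) else 0)"

lemma poly_times_exp_minus_tendsto_0:
  "((\<lambda>s. poly P s * exp (- s)) \<longlongrightarrow> 0) (at_top :: real filter)"
proof -
  have "((\<lambda>s. \<Sum>i\<le>degree P. coeff P i * (s ^ i / exp s)) \<longlongrightarrow> (\<Sum>i\<le>degree P. coeff P i * 0)) at_top"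
    by (intro tendsto_intros tendsto_power_div_exp_0)
  then show ?thesis
    by (simp add: poly_altdef sum_distrib_right exp_minus divide_inverse mult.assoc)
qed

lemma flat_exp_tendsto_0: "(flat_exp P \<longlongrightarrow> 0) (at 0)"
proof -
  have "((\<lambda>t. poly P (inverse t) * exp (- inverse t)) \<longlongrightarrow> 0) (at_right 0)"
    by (rule filterlim_compose[OF poly_times_exp_minus_tendsto_0 filterlim_inverse_at_top_right])
  moreover have "eventually (\<lambda>t. poly P (inverse t) * exp (- inverse t) = flat_exp P t) (at_right 0)"
    by (auto simp: eventually_at_filter flat_exp_def inverse_eq_divide)
  ultimately have r: "(flat_exp P \<longlongrightarrow> 0) (at_right 0)"
    using tendsto_cong by fastforce
  have "eventually (\<lambda>t. flat_exp P t = 0) (at_left 0)"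
    by (auto simp: eventually_at_filter flat_exp_def)
  then have "(flat_exp P \<longlongrightarrow> 0) (at_left 0)"
    by (rule tendsto_eventually)
  with r show ?thesis by (simp add: filterlim_split_at)
qed

text \<open>
  On \<open>t > 0\<close> this is the product rule; the square comes from the derivative \<open>-1/t\<^sup>2\<close> of \<open>1/t\<close>. At \<open>0\<close> the difference quotient of \<open>flat_exp P\<close> is again a
  member of the family, with \<open>P\<close> multiplied by the variable, and so it tends to \<open>0\<close>.
\<close>

lemma flat_exp_has_field_derivative:
  "(flat_exp P has_field_derivative flat_exp ([:0, 0, 1:] * (P - pderiv P)) t) (at t)"
proof -
  consider "t > 0" | "t < 0" | "t = 0" by linarith
  then show ?thesis
  proof cases
    case 1
    have "((\<lambda>t. poly P (1 / t) * exp (- (1 / t))) has_field_derivative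
        flat_exp ([:0, 0, 1:] * (P - pderiv P)) t) (at t)"
      using 1 by (auto intro!: derivative_eq_intros simp: flat_exp_def field_simps power2_eq_square)
    then show ?thesis
      by (rule has_field_derivative_transform_within_open[where S = "{0<..}"]) (use 1 in \<open>auto simp: flat_exp_def\<close>)
  next
    case 2
    have "((\<lambda>t. 0) has_field_derivative flat_exp ([:0, 0, 1:] * (P - pderiv P)) t) (at t)"
      using 2 by (auto simp: flat_exp_def)
    then show ?thesis
      by (rule has_field_derivative_transform_within_open[where S = "{..<0}"]) (use 2 in \<open>auto simp: flat_exp_def\<close>)
  next
    case 3
    have "(flat_exp P (0 + h) - flat_exp P 0) / h = flat_exp (pCons 0 P) h" for h
      by (simp add: flat_exp_def)
    moreover have "flat_exp ([:0, 0, 1:] * (P - pderiv P)) 0 = 0"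
      by (simp add: flat_exp_def)
    ultimately show ?thesis
      unfolding DERIV_def 3 using flat_exp_tendsto_0[of "pCons 0 P"] by presburger
  qed
qed

lemma Ck_on_flat_exp: "Ck_on k UNIV (flat_exp P)"
proof (induction k arbitrary: P)
  case 0
  show ?case
    using DERIV_isCont[OF flat_exp_has_field_derivative] by (simp add: continuous_on_eq_continuous_at)
next
  case (Suc k)
  let ?Q = "[:0, 0, 1:] * (P - pderiv P)"
  show ?case
  proof (rule Ck_on_SucI)
    show "(flat_exp P has_derivative (\<lambda>v. flat_exp ?Q x * v)) (at x)" for x
      using flat_exp_has_field_derivative by (simp add: has_field_derivative_def)
    \<comment> \<open>the directional derivative belongs to the family as well, so the induction hypothesis applies\<close>
    have "flat_exp (smult v ?Q) = (\<lambda>x. flat_exp ?Q x * v)" for v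
      by (auto simp: flat_exp_def fun_eq_iff)
    then show "Ck_on k UNIV (\<lambda>x. flat_exp ?Q x * v)" for v
      using Suc.IH[of "smult v ?Q"] by simp
  qed simp
qed

text \<open>
  The squared distance is written as an inner product because that is bilinear, and so
  visibly smooth.
\<close>

definition bump :: "'a::euclidean_space \<Rightarrow> real \<Rightarrow> 'a \<Rightarrow> real" where
  "bump x\<^sub>0 r x = flat_exp 1 (r\<^sup>2 - (x - x\<^sub>0) \<bullet> (x - x\<^sub>0))"

lemma smooth_on_bump: "smooth_on UNIV (bump x\<^sub>0 r)"
proof -
  \<comment> \<open>differences are written as sums to fit the closure properties\<close>
  have id: "Ck_on k UNIV (\<lambda>x::'a. x + (- x\<^sub>0))" for k
    by (intro Ck_on_add Ck_on_const Ck_on_bounded_linear bounded_linear_ident) auto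
  have "Ck_on k UNIV (\<lambda>x. r\<^sup>2 + (- ((x + (- x\<^sub>0)) \<bullet> (x + (- x\<^sub>0)))))" for k
    by (intro Ck_on_add Ck_on_const Ck_on_bounded_bilinear[OF bounded_bilinear_inner] id
        Ck_on_bounded_linear_compose[OF bounded_linear_minus] bounded_linear_ident) auto
  then have "Ck_on k UNIV (\<lambda>x. r\<^sup>2 - (x - x\<^sub>0) \<bullet> (x - x\<^sub>0))" for k
    by simp
  from Ck_on_compose[OF open_UNIV open_UNIV _ Ck_on_flat_exp this]
  have "Ck_on k UNIV (\<lambda>x. flat_exp 1 (r\<^sup>2 - (x - x\<^sub>0) \<bullet> (x - x\<^sub>0)))" for k
    by simp
  then show ?thesis unfolding smooth_on_def bump_def[abs_def] by simp
qed

lemma bump_pos_center: "r > 0 \<Longrightarrow> bump x\<^sub>0 r x\<^sub>0 > 0"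
  by (simp add: bump_def flat_exp_def)

lemma bump_eq_0_outside:
  assumes "r > 0" "x \<notin> cball x\<^sub>0 r" shows "bump x\<^sub>0 r x = 0"
proof -
  have "r < norm (x - x\<^sub>0)" using assms by (simp add: dist_norm norm_minus_commute)
  then have "r\<^sup>2 \<le> (norm (x - x\<^sub>0))\<^sup>2" using assms(1) by (intro power_mono) auto
  then show ?thesis by (simp add: bump_def flat_exp_def dot_square_norm)
qed

section \<open>Orthonormal families for an inner product\<close>

text \<open>
  One Gram-Schmidt step per index: by dimension, some \<open>w \<noteq> 0\<close> is Euclidean-orthogonal to the
  vectors that represent the functionals \<open>B (u i)\<close>, i.e. it is \<open>B\<close>-orthogonal to all \<open>u i\<close>; it only
  has to be normalised.
\<close>

lemma orthonormal_family_exists: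
  fixes B :: "'a::euclidean_space \<Rightarrow> 'a \<Rightarrow> real"
  assumes "bilinear B" "\<And>v w. B v w = B w v" "\<And>v. v \<noteq> 0 \<Longrightarrow> B v v > 0"
    and "finite I" "card I \<le> DIM('a)"
  shows "\<exists>u. \<forall>i\<in>I. \<forall>j\<in>I. B (u i) (u j) = (if i = j then 1 else 0)"
  using assms(4,5)
proof (induction I)
  case (insert j I)
  then obtain u where u: "\<And>i k. i \<in> I \<Longrightarrow> k \<in> I \<Longrightarrow> B (u i) (u k) = (if i = k then 1 else 0)"
    by auto
  \<comment> \<open>\<open>?dual v\<close> represents the functional \<open>B v\<close> in the Euclidean inner product\<close>
  let ?dual = "\<lambda>v. \<Sum>b\<in>Basis. B v b *\<^sub>R b"
  have dual: "?dual v \<bullet> w = B v w" for v w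
  proof -
    have "linear (B v)" using assms(1) by (simp add: bilinear_def)
    then have "B v (\<Sum>b\<in>Basis. (w \<bullet> b) *\<^sub>R b) = (\<Sum>b\<in>Basis. (w \<bullet> b) * B v b)"
      by (simp add: linear_sum linear_cmul)
    then show ?thesis
      by (simp add: euclidean_representation inner_sum_left inner_sum_right inner_commute[of _ w] mult.commute)
  qed
  have "dim ((\<lambda>i. ?dual (u i)) ` I) \<le> card ((\<lambda>i. ?dual (u i)) ` I)"
    using insert by (intro dim_le_card') auto
  also have "\<dots> \<le> card I" using insert by (intro card_image_le)
  also have "\<dots> < DIM('a)" using insert by simp
  finally have "dim ((\<lambda>i. ?dual (u i)) ` I) < DIM('a)" .
  from lowdim_subset_hyperplane[OF this]
  obtain w where w: "w \<noteq> 0" "span ((\<lambda>i. ?dual (u i)) ` I) \<subseteq> {x. w \<bullet> x = 0}"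
    by blast
  have orth: "B (u i) w = 0" if "i \<in> I" for i
  proof -
    have "?dual (u i) \<in> span ((\<lambda>i. ?dual (u i)) ` I)"
      by (rule span_base) (use that in simp)
    with w(2) have "w \<bullet> ?dual (u i) = 0" by blast
    then show ?thesis using dual[of "u i" w] by (simp only: inner_commute)
  qed
  let ?s = "1 / sqrt (B w w)"
  have sc: "B (c *\<^sub>R x) y = c * B x y" "B x (c *\<^sub>R y) = c * B x y" for c x y
    using assms(1) by (simp_all add: bilinear_lmul bilinear_rmul)
  have norm: "?s * (?s * B w w) = 1"
  proof -
    have "?s * (?s * B w w) = B w w / (sqrt (B w w))\<^sup>2" by (simp add: power2_eq_square)
    then show ?thesis using assms(3)[OF w(1)] by simp
  qed
  show ?case
  proof (intro exI ballI)
    fix i k assume ik: "i \<in> insert j I" "k \<in> insert j I"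
    have orth': "B w (u i) = 0" if "i \<in> I" for i
      using orth[OF that] assms(2) by metis
    show "B ((u(j := ?s *\<^sub>R w)) i) ((u(j := ?s *\<^sub>R w)) k) = (if i = k then 1 else 0)"
      using ik insert(2) u orth orth' norm by (cases "i = j"; cases "k = j") (simp_all add: sc)
  qed
qed simp

section \<open>Smooth functions on a manifold\<close>

lemma smooth_atlas_chart:
  assumes "smooth_atlas A" "(U, c) \<in> A"
  shows "open U" "open (c ` U)" "homeomorphism U (c ` U) c (inv_into U c)"
proof -
  have "is_chart (U, c)" using assms by (auto simp: smooth_atlas_def)
  then obtain c' where *: "open U" "open (c ` U)" "homeomorphism U (c ` U) c c'"
    by (auto simp: is_chart_def)
  then show "open U" "open (c ` U)" by auto
  have inv: "c' (c x) = x" if "x \<in> U" for x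
    using homeomorphism_apply1[OF *(3) that] .
  then have "inj_on c U" by (rule inj_on_inverseI)
  then have "inv_into U c y = c' y" if "y \<in> c ` U" for y
    using that inv by auto
  then show "homeomorphism U (c ` U) c (inv_into U c)"
    by (intro homeomorphism_cong[OF *(3)]) simp_all
qed

lemma chart_inv:
  assumes "smooth_atlas A" "(U, c) \<in> A" "q \<in> U"
  shows "inv_into U c (c q) = q"
  using smooth_atlas_chart(3)[OF assms(1,2)] assms(3) by (rule homeomorphism_apply1)

text \<open>
  Smoothness is local on open subsets of coordinate space, so overlaps of chart domains with
  open sets must have open images.
\<close>

lemma chart_image_open:
  assumes "smooth_atlas A" "(U, c) \<in> A" "open W"
  shows "open (c ` (U \<inter> W))"
proof -
  note chart = smooth_atlas_chart[OF assms(1,2)]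
  have "openin (top_of_set U) (U \<inter> W)"
    using assms(3) by (simp add: openin_open_Int)
  then have "openin (top_of_set (c ` U)) (c ` (U \<inter> W))"
    by (rule homeomorphism_imp_open_map[OF chart(3)])
  then show ?thesis using chart(2) by (simp add: openin_open_eq)
qed

lemma smooth_functions_local:
  "f \<in> smooth_functions A \<Longrightarrow> (U, c) \<in> A \<Longrightarrow> smooth_on (c ` U) (f \<circ> inv_into U c)"
  by (auto simp: smooth_functions_def)

lemma smooth_functionsI:
  "(\<And>U c. (U, c) \<in> A \<Longrightarrow> smooth_on (c ` U) (f \<circ> inv_into U c)) \<Longrightarrow> f \<in> smooth_functions A"
  by (auto simp: smooth_functions_def)

lemma smooth_functions_const:
  assumes "smooth_atlas A" shows "(\<lambda>_. r) \<in> smooth_functions A"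
  by (rule smooth_functionsI)
    (auto simp: smooth_on_def o_def intro!: Ck_on_const smooth_atlas_chart(2)[OF assms])

lemma smooth_functions_add:
  assumes "smooth_atlas A" "u \<in> smooth_functions A" "v \<in> smooth_functions A"
  shows "u + v \<in> smooth_functions A"
proof (rule smooth_functionsI)
  fix U c assume C: "(U, c) \<in> A"
  show "smooth_on (c ` U) ((u + v) \<circ> inv_into U c)"
    using smooth_on_add[OF smooth_atlas_chart(2)[OF assms(1) C]
        smooth_functions_local[OF assms(2) C] smooth_functions_local[OF assms(3) C]]
    by (simp add: o_def)
qed

lemma smooth_functions_mult:
  assumes "smooth_atlas A" "u \<in> smooth_functions A" "v \<in> smooth_functions A"
  shows "u * v \<in> smooth_functions A"
proof (rule smooth_functionsI)
  fix U c assume C: "(U, c) \<in> A"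
  show "smooth_on (c ` U) ((u * v) \<circ> inv_into U c)"
    using smooth_on_mult[OF smooth_atlas_chart(2)[OF assms(1) C]
        smooth_functions_local[OF assms(2) C] smooth_functions_local[OF assms(3) C]]
    by (simp add: o_def)
qed

lemma smooth_functions_diff:
  assumes "smooth_atlas A" "u \<in> smooth_functions A" "v \<in> smooth_functions A"
  shows "u - v \<in> smooth_functions A"
proof -
  have "u + (\<lambda>_. -1) * v \<in> smooth_functions A"
    by (intro smooth_functions_add smooth_functions_mult smooth_functions_const assms)
  also have "u + (\<lambda>_. -1) * v = u - v" by (auto simp: fun_eq_iff)
  finally show ?thesis .
qed

text \<open>
  In another chart \<open>U'\<close> the extended function is smooth on the part of \<open>U'\<close> that lies in \<open>U\<close>, by
  composition with the transition map, and vanishes on the part of \<open>U'\<close> outside the preimage of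
  \<open>K\<close>. These parts cover \<open>U'\<close>, and both are open: that preimage is compact, and a compact
  set is closed because the manifold is Hausdorff.
\<close>

lemma extension_by_zero_smooth:
  assumes atlas: "smooth_atlas A" and C: "(U, c) \<in> A" and w: "smooth_on (c ` U) w"
    and K: "compact K" "K \<subseteq> c ` U" "\<And>y. y \<in> c ` U - K \<Longrightarrow> w y = 0"
  shows "(\<lambda>q. if q \<in> U then w (c q) else 0) \<in> smooth_functions A" (is "?u \<in> _")
proof (rule smooth_functionsI)
  fix U' c' assume C': "(U', c') \<in> A"
  note chart = smooth_atlas_chart[OF atlas C]
  define L where "L = inv_into U c ` K"
  have "compact L" unfolding L_def
    using continuous_on_subset[OF homeomorphism_cont2[OF chart(3)] K(2)] K(1)
    by (rule compact_continuous_image)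
  then have "closed L" by (rule compact_imp_closed)
  have "L \<subseteq> U"
    using K(2) homeomorphism_image2[OF chart(3)] unfolding L_def by blast
  have o1: "open (c' ` (U' \<inter> U))" and o2: "open (c' ` (U' \<inter> - L))"
    using chart_image_open[OF atlas C'] chart(1) \<open>closed L\<close> by (auto simp: open_Compl)
  have "Ck_on k (c' ` (U' \<inter> U)) (?u \<circ> inv_into U' c')" for k
  proof (rule Ck_on_cong[OF o1])
    have "\<forall>(U', c')\<in>A. \<forall>(U, c)\<in>A. smooth_on (c' ` (U' \<inter> U)) (c \<circ> inv_into U' c')"
      using atlas unfolding smooth_atlas_def by (rule conjunct2[OF conjunct2])
    then have "smooth_on (c' ` (U' \<inter> U)) (c \<circ> inv_into U' c')"
      using C C' by fast
    then show "Ck_on k (c' ` (U' \<inter> U)) (\<lambda>y. w ((c \<circ> inv_into U' c') y))"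
      using w unfolding smooth_on_def
      by (intro Ck_on_compose[OF o1 chart(2), where f = w and g = "c \<circ> inv_into U' c'"])
        (auto simp: chart_inv[OF atlas C'])
  qed (auto simp: chart_inv[OF atlas C'])
  moreover have "Ck_on k (c' ` (U' \<inter> - L)) (?u \<circ> inv_into U' c')" for k
  proof (rule Ck_on_cong[OF o2])
    show "Ck_on k (c' ` (U' \<inter> - L)) (\<lambda>y. 0 :: real)" by (rule Ck_on_const[OF o2])
    fix y assume "y \<in> c' ` (U' \<inter> - L)"
    then obtain x where x: "x \<in> U'" "x \<notin> L" "y = c' x" by auto
    have "w (c x) = 0" if "x \<in> U"
    proof -
      have "c x \<notin> K" using x(2) that chart_inv[OF atlas C that] by (force simp: L_def)
      then show ?thesis using K(3) that by auto
    qed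
    then show "0 = (?u \<circ> inv_into U' c') y" using x by (simp add: chart_inv[OF atlas C'])
  qed
  ultimately have "Ck_on k (c' ` (U' \<inter> U) \<union> c' ` (U' \<inter> - L)) (?u \<circ> inv_into U' c')" for k
    by (intro Ck_on_Un o1 o2)
  moreover have "c' ` (U' \<inter> U) \<union> c' ` (U' \<inter> - L) = c' ` U'"
    using \<open>L \<subseteq> U\<close> by auto
  ultimately show "smooth_on (c' ` U') (?u \<circ> inv_into U' c')" by (simp add: smooth_on_def)
qed

section \<open>Global vector fields through a point\<close>

text \<open>
  A coordinate derivation, cut off by \<open>b\<close> so that it can be extended by zero. The test for smoothness
  of \<open>f\<close> implements the convention of \<^const>\<open>vector_fields\<close> on functions that are not smooth.
\<close>

definition chart_field ::
    "('m::topological_space, 'd::finite) chart set \<Rightarrow> ('m, 'd) chart \<Rightarrow> (real ^ 'd \<Rightarrow> real) \<Rightarrow>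
     real ^ 'd \<Rightarrow> 'm vfield" where
  "chart_field A = (\<lambda>(U, c) b v f. if f \<in> smooth_functions A
     then (\<lambda>q. if q \<in> U then b (c q) * frechet_derivative (f \<circ> inv_into U c) (at (c q)) v else 0)
     else 0)"

lemma chart_has_derivative:
  assumes "smooth_atlas A" "(U, c) \<in> A" "f \<in> smooth_functions A" "q \<in> U"
  shows "((f \<circ> inv_into U c) has_derivative frechet_derivative (f \<circ> inv_into U c) (at (c q))) (at (c q))"
  using assms
  by (intro smooth_on_has_derivative[OF smooth_atlas_chart(2) smooth_functions_local]) auto

lemma chart_field_vector_field:
  assumes atlas: "smooth_atlas A" and C: "(U, c) \<in> A" and b: "smooth_on (c ` U) b"
    and K: "compact K" "K \<subseteq> c ` U" "\<And>y. y \<notin> K \<Longrightarrow> b y = 0"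
  shows "chart_field A (U, c) b v \<in> vector_fields A"
proof -
  let ?X = "chart_field A (U, c) b v"
  note der = chart_has_derivative[OF atlas C]
  have smooth: "?X f \<in> smooth_functions A" if f: "f \<in> smooth_functions A" for f
  proof -
    have "smooth_on (c ` U) (\<lambda>y. b y * frechet_derivative (f \<circ> inv_into U c) (at y) v)"
      by (intro smooth_on_mult smooth_atlas_chart(2)[OF atlas C] b
          smooth_on_directional_derivative smooth_functions_local[OF f C])
    from extension_by_zero_smooth[OF atlas C this K(1,2)] K(3) f
    show ?thesis by (simp add: chart_field_def)
  qed
  have add: "?X (f + g) = ?X f + ?X g"
    if f: "f \<in> smooth_functions A" and g: "g \<in> smooth_functions A" for f g
  proof -
    have "((f + g) \<circ> inv_into U c has_derivative
        (\<lambda>v. frechet_derivative (f \<circ> inv_into U c) (at (c q)) v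
          + frechet_derivative (g \<circ> inv_into U c) (at (c q)) v)) (at (c q))" if "q \<in> U" for q
      using has_derivative_add[OF der[OF f that] der[OF g that]] by (simp add: o_def)
    note fun_cong[OF frechet_derivative_at[OF this], of _ v, symmetric]
    then show ?thesis
      using f g smooth_functions_add[OF atlas f g]
      by (auto simp: chart_field_def fun_eq_iff algebra_simps)
  qed
  have mult: "?X (f * g) = ?X f * g + f * ?X g"
    if f: "f \<in> smooth_functions A" and g: "g \<in> smooth_functions A" for f g
  proof -
    have "((f * g) \<circ> inv_into U c has_derivative
        (\<lambda>v. f q * frechet_derivative (g \<circ> inv_into U c) (at (c q)) v
          + frechet_derivative (f \<circ> inv_into U c) (at (c q)) v * g q)) (at (c q))" if "q \<in> U" for q
      using has_derivative_mult[OF der[OF f that] der[OF g that]]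
      by (simp add: o_def chart_inv[OF atlas C that])
    note fun_cong[OF frechet_derivative_at[OF this], of _ v, symmetric]
    then show ?thesis
      using f g smooth_functions_mult[OF atlas f g]
      by (auto simp: chart_field_def fun_eq_iff algebra_simps)
  qed
  \<comment> \<open>with the product rule, this gives homogeneity\<close>
  have const: "?X (\<lambda>_. r) = 0" for r
  proof -
    have "((\<lambda>_. r) \<circ> inv_into U c has_derivative (\<lambda>v. 0)) (at y)" for y
      by (simp add: o_def)
    note fun_cong[OF frechet_derivative_at[OF this], of _ v, symmetric]
    then show ?thesis
      by (auto simp: chart_field_def fun_eq_iff)
  qed
  show ?thesis
    unfolding vector_fields_def
    using smooth add by (simp add: mult const smooth_functions_const[OF atlas]) (simp add: chart_field_def)
qed

lemma chart_field_linear: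
  assumes "smooth_atlas A" "(U, c) \<in> A"
  shows "chart_field A (U, c) b (v + w) = chart_field A (U, c) b v + chart_field A (U, c) b w"
    and "chart_field A (U, c) b (r *\<^sub>R v) = (\<lambda>_. r) *\<^sub>F chart_field A (U, c) b v"
  using chart_has_derivative[OF assms, THEN has_derivative_linear]
  by (auto simp: chart_field_def fscale_def fun_eq_iff linear_add linear_cmul algebra_simps)

text \<open>
  The coordinate function \<open>y \<mapsto> (y - c p) \<bullet> v\<close>, itself cut off by \<open>b\<close>, is a global smooth function
  that detects the field at \<open>p\<close>. Since \<open>(y - c p) \<bullet> v\<close> vanishes at \<open>c p\<close>, differentiating the cut-off
  contributes nothing there, and the field takes the value \<open>b(c p)\<^sup>2 |v|\<^sup>2\<close> on this function at \<open>p\<close>.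
\<close>

lemma chart_field_nonzero:
  assumes atlas: "smooth_atlas A" and C: "(U, c) \<in> A" and b: "smooth_on (c ` U) b"
    and K: "compact K" "K \<subseteq> c ` U" "\<And>y. y \<notin> K \<Longrightarrow> b y = 0"
    and p: "p \<in> U" "b (c p) \<noteq> 0" and v: "v \<noteq> 0"
  shows "nonzero_at A (chart_field A (U, c) b v) p"
proof -
  note chart = smooth_atlas_chart[OF atlas C]
  let ?w = "\<lambda>y. b y * ((y + (- c p)) \<bullet> v)"
  let ?F = "\<lambda>q. if q \<in> U then ?w (c q) else 0"
  have "smooth_on (c ` U) (\<lambda>y. (y + (- c p)) \<bullet> v)"
    unfolding smooth_on_def
    by (intro allI Ck_on_bounded_linear_compose[OF bounded_linear_inner_left] Ck_on_add Ck_on_const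
        Ck_on_bounded_linear bounded_linear_ident chart(2))
  then have "smooth_on (c ` U) ?w"
    by (intro smooth_on_mult chart(2) b)
  from extension_by_zero_smooth[OF atlas C this K(1,2)] K(3)
  have F: "?F \<in> smooth_functions A" by simp
  have "(b has_derivative frechet_derivative b (at (c p))) (at (c p))"
    using smooth_on_has_derivative[OF chart(2) b] p by simp
  moreover have "((\<lambda>y. (y + (- c p)) \<bullet> v) has_derivative (\<lambda>h. h \<bullet> v)) (at (c p))"
    by (auto intro!: derivative_eq_intros)
  ultimately have "(?w has_derivative (\<lambda>h. b (c p) * (h \<bullet> v))) (at (c p))"
    using has_derivative_mult by fastforce
  then have "(?F \<circ> inv_into U c has_derivative (\<lambda>h. b (c p) * (h \<bullet> v))) (at (c p))"
    by (rule has_derivative_transform_within_open[OF _ chart(2)])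
      (use p in \<open>auto simp: chart_inv[OF atlas C]\<close>)
  from frechet_derivative_at[OF this]
  have "chart_field A (U, c) b v ?F p = b (c p) * (b (c p) * (v \<bullet> v))"
    using F p(1) by (simp add: chart_field_def) metis
  then show ?thesis
    unfolding nonzero_at_def using F p v by (intro bexI[of _ ?F]) auto
qed

text \<open>
  The manifold has enough global vector fields: the values at \<open>p\<close> of the fields \<open>X v\<close> form a space
  of dimension \<open>CARD('d)\<close>. The fields depend linearly on \<open>v\<close>, so a metric evaluated at \<open>p\<close> pulls back
  to an inner product on coordinate space.
\<close>

lemma vector_fields_spanning_tangent_space:
  fixes A :: "('m::{t2_space, second_countable_topology}, 'd::finite) chart set"
  assumes atlas: "smooth_atlas A"
  obtains X :: "real ^ 'd \<Rightarrow> 'm vfield"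
  where "\<And>v. X v \<in> vector_fields A" "\<And>v w. X (v + w) = X v + X w"
    "\<And>r v. X (r *\<^sub>R v) = (\<lambda>_. r) *\<^sub>F X v" "\<And>v. v \<noteq> 0 \<Longrightarrow> nonzero_at A (X v) p"
proof -
  have "p \<in> (\<Union>(U, c)\<in>A. U)" using atlas by (simp add: smooth_atlas_def)
  then obtain U c where C: "(U, c) \<in> A" and p: "p \<in> U" by auto
  obtain r where r: "r > 0" "cball (c p) r \<subseteq> c ` U"
    using smooth_atlas_chart(2)[OF atlas C] p open_contains_cball by blast
  let ?b = "bump (c p) r"
  have b: "smooth_on (c ` U) ?b"
    using smooth_on_bump Ck_on_subset unfolding smooth_on_def by blast
  note K = compact_cball r(2) bump_eq_0_outside[OF r(1)]
  show thesis
    by (rule that[of "chart_field A (U, c) ?b"])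
      (use chart_field_vector_field[OF atlas C b K] chart_field_linear[OF atlas C]
        chart_field_nonzero[OF atlas C b K p] bump_pos_center[OF r(1), of "c p"] in auto)
qed

section \<open>Algebra of vector fields and tensor fields\<close>

lemma vector_fieldsD:
  assumes "X \<in> vector_fields A"
  shows "f \<in> smooth_functions A \<Longrightarrow> X f \<in> smooth_functions A"
    and "f \<in> smooth_functions A \<Longrightarrow> g \<in> smooth_functions A \<Longrightarrow> X (f + g) = X f + X g"
    and "f \<in> smooth_functions A \<Longrightarrow> X ((\<lambda>_. r) * f) = (\<lambda>_. r) * X f"
    and "f \<in> smooth_functions A \<Longrightarrow> g \<in> smooth_functions A \<Longrightarrow> X (f * g) = X f * g + f * X g"
    and "f \<notin> smooth_functions A \<Longrightarrow> X f = 0"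
  using assms by (simp_all add: vector_fields_def)

lemma vector_field_zero:
  assumes "smooth_atlas A" "X \<in> vector_fields A" shows "X 0 = 0"
  using vector_fieldsD(3)[OF assms(2) smooth_functions_const[OF assms(1), of 0], of 0]
  by (simp add: zero_fun_def times_fun_def)

lemma vector_fieldsI:
  assumes "\<And>f. f \<in> smooth_functions A \<Longrightarrow> X f \<in> smooth_functions A"
    and "\<And>f g p. f \<in> smooth_functions A \<Longrightarrow> g \<in> smooth_functions A \<Longrightarrow> X (f + g) p = X f p + X g p"
    and "\<And>r f p. f \<in> smooth_functions A \<Longrightarrow> X ((\<lambda>_. r) * f) p = r * X f p"
    and "\<And>f g p. f \<in> smooth_functions A \<Longrightarrow> g \<in> smooth_functions A \<Longrightarrow>
      X (f * g) p = X f p * g p + f p * X g p"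
    and "\<And>f p. f \<notin> smooth_functions A \<Longrightarrow> X f p = 0"
  shows "X \<in> vector_fields A"
  unfolding vector_fields_def using assms by (auto simp: fun_eq_iff)

lemma vector_fields_add:
  assumes "smooth_atlas A" "X \<in> vector_fields A" "Y \<in> vector_fields A"
  shows "X + Y \<in> vector_fields A"
  by (rule vector_fieldsI)
    (use assms(2,3) in \<open>simp_all add: vector_fieldsD smooth_functions_add[OF assms(1)]
      distrib_left distrib_right add_ac\<close>)

lemma vector_fields_scale:
  assumes "smooth_atlas A" "h \<in> smooth_functions A" "X \<in> vector_fields A"
  shows "h *\<^sub>F X \<in> vector_fields A"
  by (rule vector_fieldsI)
    (use assms(2,3) in \<open>simp_all add: fscale_def vector_fieldsD smooth_functions_mult[OF assms(1)]
      distrib_left mult.assoc mult.left_commute\<close>)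

text \<open>
  In \<open>[X, Y](f g)\<close> the mixed terms \<open>X f \<cdot> Y g\<close> and \<open>Y f \<cdot> X g\<close> cancel, which leaves the product rule.
\<close>

lemma vector_fields_bracket:
  assumes atlas: "smooth_atlas A" and X: "X \<in> vector_fields A" and Y: "Y \<in> vector_fields A"
  shows "bracket X Y \<in> vector_fields A"
proof (rule vector_fieldsI)
  note D = vector_fieldsD[OF X] vector_fieldsD[OF Y]
  fix f p assume f: "f \<in> smooth_functions A"
  show "bracket X Y f \<in> smooth_functions A"
    unfolding bracket_def by (intro smooth_functions_diff[OF atlas] D f)
  show "bracket X Y ((\<lambda>_. r) * f) p = r * bracket X Y f p" for r
    unfolding bracket_def D(3)[OF f] D(8)[OF f] D(3)[OF D(6)[OF f]] D(8)[OF D(1)[OF f]]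
    by (simp add: right_diff_distrib)
  fix g assume g: "g \<in> smooth_functions A"
  show "bracket X Y (f + g) p = bracket X Y f p + bracket X Y g p"
    unfolding bracket_def D(2)[OF f g] D(7)[OF f g]
      D(2)[OF D(6)[OF f] D(6)[OF g]] D(7)[OF D(1)[OF f] D(1)[OF g]]
    by simp
  note prod = smooth_functions_mult[OF atlas]
  show "bracket X Y (f * g) p = bracket X Y f p * g p + f p * bracket X Y g p"
    unfolding bracket_def D(4)[OF f g] D(9)[OF f g]
      D(2)[OF prod[OF D(6)[OF f] g] prod[OF f D(6)[OF g]]]
      D(7)[OF prod[OF D(1)[OF f] g] prod[OF f D(1)[OF g]]]
      D(4)[OF D(6)[OF f] g] D(4)[OF f D(6)[OF g]] D(9)[OF D(1)[OF f] g] D(9)[OF f D(1)[OF g]]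
    by (simp add: algebra_simps)
next
  fix f p assume "f \<notin> smooth_functions A"
  then show "bracket X Y f p = 0"
    by (simp add: bracket_def vector_fieldsD(5)[OF X] vector_fieldsD(5)[OF Y]
        vector_field_zero[OF atlas X] vector_field_zero[OF atlas Y] zero_fun_def[symmetric])
qed

lemma one_formD:
  assumes "one_form A \<alpha>" "X \<in> vector_fields A"
  shows "\<alpha> X \<in> smooth_functions A"
    and "Y \<in> vector_fields A \<Longrightarrow> \<alpha> (X + Y) = \<alpha> X + \<alpha> Y"
    and "h \<in> smooth_functions A \<Longrightarrow> \<alpha> (h *\<^sub>F X) = h * \<alpha> X"
  using assms unfolding one_form_def by blast+

lemma tensor02D:
  assumes "tensor02 A T" "X \<in> vector_fields A" "Y \<in> vector_fields A"
  shows "T X Y \<in> smooth_functions A"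
    and "Z \<in> vector_fields A \<Longrightarrow> T (X + Z) Y = T X Y + T Z Y"
    and "Z \<in> vector_fields A \<Longrightarrow> T X (Y + Z) = T X Y + T X Z"
    and "h \<in> smooth_functions A \<Longrightarrow> T (h *\<^sub>F X) Y = h * T X Y"
    and "h \<in> smooth_functions A \<Longrightarrow> T X (h *\<^sub>F Y) = h * T X Y"
proof -
  have "one_form A (T X)" "one_form A (\<lambda>X. T X Y)"
    using assms unfolding tensor02_def by auto
  note one_formD[OF this(1) assms(3)] one_formD[OF this(2) assms(2)]
  then show "T X Y \<in> smooth_functions A"
    and "Z \<in> vector_fields A \<Longrightarrow> T (X + Z) Y = T X Y + T Z Y"
    and "Z \<in> vector_fields A \<Longrightarrow> T X (Y + Z) = T X Y + T X Z"
    and "h \<in> smooth_functions A \<Longrightarrow> T (h *\<^sub>F X) Y = h * T X Y"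
    and "h \<in> smooth_functions A \<Longrightarrow> T X (h *\<^sub>F Y) = h * T X Y"
    by blast+
qed

section \<open>Riemannian metrics\<close>

lemma riemannian_metricD:
  assumes "riemannian_metric A h"
  shows "tensor02 A h"
    and "X \<in> vector_fields A \<Longrightarrow> Y \<in> vector_fields A \<Longrightarrow> h X Y = h Y X"
    and "X \<in> vector_fields A \<Longrightarrow> nonzero_at A X p \<Longrightarrow> h X X p > 0"
  using assms by (simp_all add: riemannian_metric_def)

text \<open>
  Without this the choice in \<^const>\<open>some_basis_at\<close> would be arbitrary, and traces and norms at \<open>p\<close>
  would mean nothing. A basis orthonormal for the inner product that \<open>h\<close> induces at \<open>p\<close>
  on coordinate space is carried over by the fields of
  \<open>vector_fields_spanning_tangent_space\<close>.
\<close>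

lemma orthonormal_basis_exists:
  fixes A :: "('m::{t2_space, second_countable_topology}, 'd::finite) chart set"
  assumes atlas: "smooth_atlas A" and h: "riemannian_metric A h"
  shows "\<exists>e. orthonormal_basis_at A h p e"
proof -
  obtain X :: "real ^ 'd \<Rightarrow> 'm vfield" where X: "\<And>v. X v \<in> vector_fields A"
    "\<And>v w. X (v + w) = X v + X w" "\<And>r v. X (r *\<^sub>R v) = (\<lambda>_. r) *\<^sub>F X v"
    "\<And>v. v \<noteq> 0 \<Longrightarrow> nonzero_at A (X v) p"
    using vector_fields_spanning_tangent_space[OF atlas] by blast
  define B where "B v w = h (X v) (X w) p" for v w
  note T = tensor02D[OF riemannian_metricD(1)[OF h]]
  have "bilinear B"
    unfolding bilinear_def
    by (intro conjI allI linearI)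
      (simp_all only: B_def X(2,3) T(2-5)[OF X(1) X(1)] X(1) smooth_functions_const[OF atlas]
        plus_fun_apply times_fun_apply real_scaleR_def)
  moreover have "B v w = B w v" for v w
    using riemannian_metricD(2)[OF h X(1) X(1), of v w] by (simp add: B_def)
  moreover have "B v v > 0" if "v \<noteq> 0" for v
    using riemannian_metricD(3)[OF h X(1) X(4)[OF that]] by (simp add: B_def)
  ultimately obtain u where
    "\<forall>i\<in>(UNIV :: 'd set). \<forall>j\<in>UNIV. B (u i) (u j) = (if i = j then 1 else 0)"
    using orthonormal_family_exists[of B "UNIV :: 'd set"] by auto
  then have "orthonormal_basis_at A h p (\<lambda>i. X (u i))"
    unfolding orthonormal_basis_at_def by (simp add: X(1) B_def)
  then show ?thesis by blast
qed

text \<open>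
  Positivity is only postulated where \<open>Y\<close> does not vanish. Where it vanishes, adding \<open>s W\<close> with
  \<open>W\<close> nonzero at \<open>p\<close> and \<open>s > 0\<close> makes it nonzero, and \<open>s \<rightarrow> 0\<close> gives the claim.
\<close>

lemma riemannian_metric_nonneg:
  fixes A :: "('m::{t2_space, second_countable_topology}, 'd::finite) chart set"
  assumes atlas: "smooth_atlas A" and h: "riemannian_metric A h" and Y: "Y \<in> vector_fields A"
  shows "h Y Y p \<ge> 0"
proof (cases "nonzero_at A Y p")
  case True
  then show ?thesis using riemannian_metricD(3)[OF h Y] by (simp add: less_imp_le)
next
  case False
  obtain X :: "real ^ 'd \<Rightarrow> 'm vfield" where X: "\<And>v. X v \<in> vector_fields A"
    "\<And>v. v \<noteq> 0 \<Longrightarrow> nonzero_at A (X v) p"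
    by (rule vector_fields_spanning_tangent_space[OF atlas, where p = p]) (rule that)
  define W where "W = X (axis undefined 1)"
  have W: "W \<in> vector_fields A" and "nonzero_at A W p"
    unfolding W_def by (rule X(1), rule X(2)) simp
  then obtain F where F: "F \<in> smooth_functions A" "W F p \<noteq> 0"
    unfolding nonzero_at_def by blast
  note T = tensor02D[OF riemannian_metricD(1)[OF h]]
  have pos: "h Y Y p + 2 * s * h Y W p + s * s * h W W p > 0" if "s > 0" for s
  proof -
    let ?W = "(\<lambda>_. s) *\<^sub>F W"
    have c: "(\<lambda>_. s) \<in> smooth_functions A" by (rule smooth_functions_const[OF atlas])
    have W': "?W \<in> vector_fields A" by (rule vector_fields_scale[OF atlas c W])
    have "Y F p = 0" using False F(1) by (auto simp: nonzero_at_def)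
    then have "(Y + ?W) F p \<noteq> 0"
      using F(2) that by (simp add: fscale_def)
    then have "nonzero_at A (Y + ?W) p"
      using F(1) unfolding nonzero_at_def by blast
    from riemannian_metricD(3)[OF h vector_fields_add[OF atlas Y W'] this]
    have "0 < h (Y + ?W) (Y + ?W) p" .
    also have "h (Y + ?W) (Y + ?W) = h Y Y + (\<lambda>_. s) * h Y W + (\<lambda>_. s) * (h Y W + (\<lambda>_. s) * h W W)"
      unfolding T(2)[OF Y vector_fields_add[OF atlas Y W'] W'] T(3)[OF Y Y W'] T(5)[OF Y W c]
        T(4)[OF W vector_fields_add[OF atlas Y W'] c] T(3)[OF W Y W'] T(5)[OF W W c]
        riemannian_metricD(2)[OF h W Y] ..
    finally show ?thesis by (simp add: algebra_simps)
  qed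
  have "((\<lambda>s. h Y Y p + 2 * s * h Y W p + s * s * h W W p) \<longlongrightarrow> h Y Y p) (at_right 0)"
    by (auto intro!: tendsto_eq_intros)
  then show ?thesis
  proof (rule tendsto_lowerbound)
    show "\<forall>\<^sub>F s in at_right 0. 0 \<le> h Y Y p + 2 * s * h Y W p + s * s * h W W p"
      using eventually_at_right_less by (rule eventually_mono) (rule less_imp_le[OF pos])
  qed simp
qed

text \<open>
  Positivity is the point. From \<open>g(\<phi>X, \<phi>X) = g(X, X) - \<eta>(X)\<^sup>2 \<ge> 0\<close> one gets \<open>\<eta>(X)\<^sup>2 \<le> g(X, X)\<close>, and so
  \<open>g(X, X) + (a - 1) \<eta>(X)\<^sup>2 \<ge> min 1 a \<cdot> g(X, X) > 0\<close>, also when \<open>a < 1\<close>.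
\<close>

lemma D_homothetic_metric_riemannian:
  fixes A :: "('m::{t2_space, second_countable_topology}, 'd::finite) chart set"
  assumes atlas: "smooth_atlas A" and acm: "almost_contact_metric A (\<phi>, \<xi>, \<eta>, g)" and a: "a > 0"
    and D: "(\<phi>', \<xi>', \<eta>', g') = D_homothetic a (\<phi>, \<xi>, \<eta>, g)"
  shows "riemannian_metric A g'"
proof -
  have g: "riemannian_metric A g" and \<phi>: "tensor11 A \<phi>" and \<eta>: "one_form A \<eta>"
    and compat: "\<And>X Y. X \<in> vector_fields A \<Longrightarrow> Y \<in> vector_fields A \<Longrightarrow>
      g (\<phi> X) (\<phi> Y) = g X Y - \<eta> X * \<eta> Y"
    using acm by (auto simp: almost_contact_metric_def)
  have g': "g' = (\<lambda>X Y. (\<lambda>_. a) * g X Y + (\<lambda>_. a * (a - 1)) * (\<eta> X * \<eta> Y))"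
    using D by (simp add: D_homothetic_def)
  note T = tensor02D[OF riemannian_metricD(1)[OF g]] and E = one_formD[OF \<eta>]
  have "tensor02 A g'"
    unfolding tensor02_def one_form_def g'
    by (simp add: T E smooth_functions_add[OF atlas] smooth_functions_mult[OF atlas]
        smooth_functions_const[OF atlas] algebra_simps)
  moreover have "g' X Y = g' Y X" if "X \<in> vector_fields A" "Y \<in> vector_fields A" for X Y
    using riemannian_metricD(2)[OF g that] by (simp add: g' mult.commute)
  moreover have "g' X X p > 0" if X: "X \<in> vector_fields A" "nonzero_at A X p" for X p
  proof -
    have "\<phi> X \<in> vector_fields A" using \<phi> X(1) by (simp add: tensor11_def)
    from riemannian_metric_nonneg[OF atlas g this, of p]
    have le: "\<eta> X p * \<eta> X p \<le> g X X p" by (simp add: compat X(1))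
    have pos: "g X X p > 0" by (rule riemannian_metricD(3)[OF g X])
    have "0 < min 1 a * g X X p" using a pos by simp
    also have "\<dots> \<le> g X X p + (a - 1) * (\<eta> X p * \<eta> X p)"
    proof (cases "a \<ge> 1")
      case False
      then have "(1 - a) * (\<eta> X p * \<eta> X p) \<le> (1 - a) * g X X p"
        using le by (intro mult_left_mono) auto
      with False show ?thesis by (simp add: algebra_simps)
    qed simp
    finally have "0 < a * (g X X p + (a - 1) * (\<eta> X p * \<eta> X p))" using a by simp
    then show ?thesis by (simp add: g' algebra_simps)
  qed
  ultimately show ?thesis unfolding riemannian_metric_def by blast
qed

section \<open>Gradient almost Riemann solitons\<close>

text \<open>
  Metric compatibility of \<open>D\<close>, applied to \<open>h(V, Y) = Y f\<close>.
\<close>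

lemma hessian_eq_metric_gradient:
  assumes "levi_civita A h D" "is_gradient A h f V" "X \<in> vector_fields A" "Y \<in> vector_fields A"
  shows "hessian D f X Y = h (D X V) Y"
proof -
  have V: "V \<in> vector_fields A" "\<And>Z. Z \<in> vector_fields A \<Longrightarrow> h V Z = Z f"
    using assms(2) by (auto simp: is_gradient_def)
  have "D X Y \<in> vector_fields A"
    using assms by (simp add: levi_civita_def affine_connection_def)
  moreover have "X (h V Y) = h (D X V) Y + h V (D X Y)"
    using assms(1,3,4) V(1) unfolding levi_civita_def by blast
  ultimately show ?thesis using V(2) assms(4) by (simp add: hessian_def)
qed

text \<open>
  This is torsion-freeness of \<open>D\<close>, applied to \<open>f\<close>.
\<close>

lemma hessian_symmetric:
  assumes "levi_civita A h D" "X \<in> vector_fields A" "Y \<in> vector_fields A"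
  shows "hessian D f X Y = hessian D f Y X"
proof -
  have "D X Y - D Y X = bracket X Y" using assms by (simp add: levi_civita_def)
  from fun_cong[OF this, of f] show ?thesis by (simp add: hessian_def bracket_def algebra_simps)
qed

text \<open>
  Metric compatibility and torsion-freeness give
  \<open>(L\<^sub>V h)(X, Y) = h(D\<^sub>X V, Y) + h(X, D\<^sub>Y V)\<close>, which for a gradient is twice the symmetric Hessian.
\<close>

lemma half_lie_derivative_gradient:
  assumes atlas: "smooth_atlas A" and h: "riemannian_metric A h" and D: "levi_civita A h D"
    and V: "is_gradient A h f V" and X: "X \<in> vector_fields A" and Y: "Y \<in> vector_fields A"
  shows "(\<lambda>_. 1 / 2) * lie_derivative V h X Y = hessian D f X Y"
proof -
  have V': "V \<in> vector_fields A" using V by (simp add: is_gradient_def)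
  have conn: "\<And>X Y. X \<in> vector_fields A \<Longrightarrow> Y \<in> vector_fields A \<Longrightarrow> D X Y \<in> vector_fields A"
    and torsion: "\<And>X Y. X \<in> vector_fields A \<Longrightarrow> Y \<in> vector_fields A \<Longrightarrow> D X Y - D Y X = bracket X Y"
    and metric: "V (h X Y) = h (D V X) Y + h X (D V Y)"
    using D V' X Y unfolding levi_civita_def affine_connection_def by blast+
  have split: "D V Z = D Z V + bracket V Z" if "Z \<in> vector_fields A" for Z
    using torsion[OF V' that] by (simp add: algebra_simps)
  note T = tensor02D(2,3)[OF riemannian_metricD(1)[OF h]]
  have "h (D V X) Y = h (D X V) Y + h (bracket V X) Y"
    and "h X (D V Y) = h X (D Y V) + h X (bracket V Y)"
    unfolding split[OF X] split[OF Y]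
    by (intro T conn X Y V' vector_fields_bracket[OF atlas])+
  with metric have "lie_derivative V h X Y = h (D X V) Y + h (D Y V) X"
    using riemannian_metricD(2)[OF h X conn[OF Y V']] by (simp add: lie_derivative_def)
  also have "\<dots> = hessian D f X Y + hessian D f X Y"
    using hessian_symmetric[OF D X Y, of f] hessian_eq_metric_gradient[OF D V X Y]
      hessian_eq_metric_gradient[OF D V Y X] by simp
  finally show ?thesis by (simp add: fun_eq_iff)
qed

text \<open>
  Writing \<open>H = (t/m) I + H\<^sub>0\<close> with \<open>m\<close> the dimension, \<open>t\<close> the trace and \<open>H\<^sub>0\<close> trace-free, the matrix
  \<open>c I - k H\<close> has squared norm \<open>m (c - k t / m)\<^sup>2 + k\<^sup>2 |H\<^sub>0|\<^sup>2\<close>, and the right-hand side of the inequality is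
  the second summand.
\<close>

lemma norm_of_pure_trace_minus_multiple:
  fixes H :: "'d::finite \<Rightarrow> 'd \<Rightarrow> real"
  shows "(\<Sum>i\<in>UNIV. \<Sum>j\<in>UNIV. (c * (if i = j then 1 else 0) - k * H i j)\<^sup>2)
    \<ge> k\<^sup>2 * ((\<Sum>i\<in>UNIV. \<Sum>j\<in>UNIV. (H i j)\<^sup>2) - 1 / real CARD('d) * (\<Sum>i\<in>UNIV. H i i)\<^sup>2)"
proof -
  define m where "m = real CARD('d)"
  define t where "t = (\<Sum>i\<in>UNIV. H i i)"
  have m: "m > 0" by (simp add: m_def)
  have "(c * (if i = j then 1 else 0) - k * H i j)\<^sup>2
      = (if i = j then c\<^sup>2 - 2 * c * k * H i i else 0) + k\<^sup>2 * (H i j)\<^sup>2" for i j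
    by (simp add: power2_eq_square algebra_simps)
  then have "(\<Sum>i\<in>UNIV. \<Sum>j\<in>UNIV. (c * (if i = j then 1 else 0) - k * H i j)\<^sup>2)
      = (\<Sum>i\<in>UNIV. c\<^sup>2 - 2 * c * k * H i i) + k\<^sup>2 * (\<Sum>i\<in>UNIV. \<Sum>j\<in>UNIV. (H i j)\<^sup>2)"
    by (simp add: sum.distrib sum_distrib_left)
  also have "(\<Sum>i\<in>UNIV. c\<^sup>2 - 2 * c * k * H i i) = m * c\<^sup>2 - 2 * c * k * t"
    by (simp add: sum_subtractf m_def t_def sum_distrib_left)
  also have "m * c\<^sup>2 - 2 * c * k * t = (m * c - k * t)\<^sup>2 / m - k\<^sup>2 * (1 / m * t\<^sup>2)"
    using m by (simp add: power2_eq_square field_simps)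
  finally show ?thesis
    using m by (simp add: m_def[symmetric] t_def[symmetric] right_diff_distrib)
qed

text \<open>
  The trace of the soliton equation over its first and last arguments, in dimension \<open>m\<close>: the
  Kulkarni-Nomizu product \<open>H \<odot> h\<close> has trace \<open>tr(H) h + (m - 2) H\<close>, hence \<open>h \<odot> h\<close> has trace
  \<open>2 (m - 1) h\<close>.
\<close>

lemma ricci_of_gradient_almost_riemann_soliton:
  fixes A :: "('m::{t2_space, second_countable_topology}, 'd::finite) chart set"
    and e :: "'d \<Rightarrow> 'm vfield"
  assumes atlas: "smooth_atlas A" and h: "riemannian_metric A h" and D: "levi_civita A h D"
    and V: "is_gradient A h f V" and sol: "almost_riemann_soliton A h D V l"
    and e: "e = some_basis_at A h p" "orthonormal_basis_at A h p e"
  shows "ricci A h D (e j) (e k) p =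
    (l p * (real CARD('d) - 1) - laplacian A h D f p) * (if j = k then 1 else 0)
      - (real CARD('d) - 2) * hessian D f (e j) (e k) p"
proof -
  have ve: "e i \<in> vector_fields A" and oe: "h (e i) (e j) p = (if i = j then 1 else 0)" for i j
    using e(2) by (auto simp: orthonormal_basis_at_def)
  define H where "H i j = hessian D f (e i) (e j) p" for i j
  have curv: "h (curvature D (e i) (e j) (e k)) (e i) p =
      l p * ((if j = k then 1 else 0) - (if i = k then if j = k then 1 else 0 else 0))
      - (H i i * (if j = k then 1 else 0) + H j k
         - (if i = j then H j k else 0) - (if i = k then H j k else 0))" for i
  proof -
    have "kulkarni_nomizu (\<lambda>X Y. (\<lambda>_. 1 / 2) * lie_derivative V h X Y) h (e i) (e j) (e k) (e i)
        + h (curvature D (e i) (e j) (e k)) (e i)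
        = (\<lambda>p. l p / 2) * kulkarni_nomizu h h (e i) (e j) (e k) (e i)"
      using sol ve by (simp add: almost_riemann_soliton_def)
    from fun_cong[OF this, of p] show ?thesis
      by (simp only: kulkarni_nomizu_def half_lie_derivative_gradient[OF atlas h D V ve ve])
        (auto simp: oe H_def)
  qed
  have lap: "laplacian A h D f p = (\<Sum>i\<in>UNIV. H i i)"
    by (simp add: laplacian_def metric_trace_def e(1)[symmetric] H_def)
  have "ricci A h D (e j) (e k) p = (\<Sum>i\<in>UNIV. h (curvature D (e i) (e j) (e k)) (e i) p)"
    by (simp add: ricci_def metric_trace_def e(1)[symmetric])
  also have "\<dots> = l p * (real CARD('d) * (if j = k then 1 else 0) - (if j = k then 1 else 0))
      - ((\<Sum>i\<in>UNIV. H i i) * (if j = k then 1 else 0) + real CARD('d) * H j k - H j k - H j k)"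
    by (simp add: curv sum_subtractf sum.distrib sum_distrib_left[symmetric] sum_distrib_right[symmetric])
  finally show ?thesis
    by (simp add: lap H_def[symmetric] algebra_simps)
qed

text \<open>
  In the chosen basis \<open>Ric\<close> has the form \<open>c I - (m - 2) H\<close>. The function \<open>\<lambda>\<close> enters only through \<open>c\<close>,
  which the norm estimate eliminates.
\<close>

lemma gradient_almost_riemann_soliton_ricci_bound:
  fixes A :: "('m::{t2_space, second_countable_topology}, 'd::finite) chart set"
  assumes atlas: "smooth_atlas A" and h: "riemannian_metric A h" and D: "levi_civita A h D"
    and V: "is_gradient A h f V" and sol: "almost_riemann_soliton A h D V l"
  shows "(hs_norm A h (ricci A h D) p)\<^sup>2 \<ge> (real CARD('d) - 2)\<^sup>2 *
    ((hs_norm A h (hessian D f) p)\<^sup>2 - 1 / real CARD('d) * (laplacian A h D f p)\<^sup>2)"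
proof -
  define e where "e = some_basis_at A h p"
  have oe: "orthonormal_basis_at A h p e"
    unfolding e_def some_basis_at_def by (rule someI_ex[OF orthonormal_basis_exists[OF atlas h]])
  have hs: "(hs_norm A h T p)\<^sup>2 = (\<Sum>i\<in>UNIV. \<Sum>j\<in>UNIV. (T (e i) (e j) p)\<^sup>2)" for T
    by (simp add: hs_norm_def e_def[symmetric] sum_nonneg)
  have lap: "laplacian A h D f p = (\<Sum>i\<in>UNIV. hessian D f (e i) (e i) p)"
    by (simp add: laplacian_def metric_trace_def e_def[symmetric])
  show ?thesis
    unfolding hs ricci_of_gradient_almost_riemann_soliton[OF atlas h D V sol e_def oe]
    unfolding lap by (rule norm_of_pure_trace_minus_multiple)
qed

section \<open>Deformed Kenmotsu manifolds\<close>

theorem theorem3p10: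
  fixes A :: "('m::{t2_space, second_countable_topology}, 'd::finite) chart set"
    and n :: nat and a :: real
    and phi phi_bar :: "'m tensor11" and xi xi_bar :: "'m vfield"
    and eta eta_bar :: "'m oneform" and g g_bar :: "'m tensor02"
    and nabla nabla_bar :: "'m connection"
    and f lambda_bar :: "'m \<Rightarrow> real" and V :: "'m vfield"
  assumes "smooth_atlas A"
    and "n \<ge> 1" and "CARD('d) = 2 * n + 1"
    and "kenmotsu A (phi, xi, eta, g) nabla"
    and "a > 0"
    and "(phi_bar, xi_bar, eta_bar, g_bar) = D_homothetic a (phi, xi, eta, g)"
    and "levi_civita A g_bar nabla_bar"
    and "f \<in> smooth_functions A"
    and "is_gradient A g_bar f V"
    and "almost_riemann_soliton A g_bar nabla_bar V lambda_bar"
  shows "\<forall>p. (hs_norm A g_bar (ricci A g_bar nabla_bar) p)\<^sup>2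
           \<ge> (2 * real n - 1)\<^sup>2 *
              ((hs_norm A g_bar (hessian nabla_bar f) p)\<^sup>2
               - 1 / (2 * real n + 1) * (laplacian A g_bar nabla_bar f p)\<^sup>2)"
proof
  fix p
  have "almost_contact_metric A (phi, xi, eta, g)"
    using assms(4) by (simp add: kenmotsu_def)
  then have "riemannian_metric A g_bar"
    using D_homothetic_metric_riemannian[OF assms(1) _ assms(5,6)] by blast
  from gradient_almost_riemann_soliton_ricci_bound[OF assms(1) this assms(7,9,10), of p]
  moreover have "real CARD('d) - 2 = 2 * real n - 1" "real CARD('d) = 2 * real n + 1"
    using assms(3) by simp_all
  ultimately show "(hs_norm A g_bar (ricci A g_bar nabla_bar) p)\<^sup>2
      \<ge> (2 * real n - 1)\<^sup>2 *
        ((hs_norm A g_bar (hessian nabla_bar f) p)\<^sup>2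
          - 1 / (2 * real n + 1) * (laplacian A g_bar nabla_bar f p)\<^sup>2)"
    by (simp only:)
qed

end
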